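(* Fix $0<c<\infty$ and let $m=cn^{3/2}$. Then as $n\to\infty$, $\|x_m-U\|_\infty\sim e^{1/(12c^2)}-1$ and $\mathrm{sep}(x_m)\sim 1-e^{-1/(24c^2)}$.
   Context: $x_m$ is the lazy $m$-shelf shuffling distribution on $S_n$: a deck of cards $1,\ldots,n$ (top to bottom) is processed in order $1,\ldots,n$; each card independently and uniformly chooses one of $2m+1$ options: shelf $0$ (placed below the cards already there), or one of shelves $1,\ldots,m$, placed either on top of or below the cards already there. The piles are then stacked with shelf $0$ on top, then shelf $1$, ..., shelf $m$; $x_m(\pi)$ is the probability that the card in position $i$ from the top is $\pi(i)$ for all $i$. $U$ is the uniform distribution on $S_n$; $\|\mathbb P-U\|_\infty=\max_{\pi\in S_n}|1-n!\,\mathbb P(\pi)|$ and $\mathrm{sep}(\mathbb P)=\max_{\pi\in S_n}(1-n!\,\mathbb P(\pi))$. *)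

theory Defs
  imports "HOL-Analysis.Analysis" "HOL-Library.Landau_Symbols" "HOL-Library.FuncSet"
begin

text \<open>Lazy m-shelf shuffle. Cards 1..n are processed in order. Card k makes a choice
  o in {0..<2m+1}: o = 0 means shelf 0, placed below the cards already there;
  o = 2j-1 (1 \<le> j \<le> m) means shelf j, placed on top; o = 2j means shelf j,
  placed below. Shelves are lists, top to bottom.\<close>

fun shelves :: "(nat \<Rightarrow> nat) \<Rightarrow> nat \<Rightarrow> (nat \<Rightarrow> nat list)" where
  "shelves ch 0 = (\<lambda>_. [])"
| "shelves ch (Suc k) =
    (let S = shelves ch k; c = ch (Suc k) in
     if c = 0 then S(0 := S 0 @ [Suc k])
     else if odd c then S((c + 1) div 2 := Suc k # S ((c + 1) div 2))
     else S(c div 2 := S (c div 2) @ [Suc k]))"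

definition shelf_deck :: "nat \<Rightarrow> nat \<Rightarrow> (nat \<Rightarrow> nat) \<Rightarrow> nat list" where
  "shelf_deck m n ch = concat (map (shelves ch n) [0..<Suc m])"

definition shelf_choices :: "nat \<Rightarrow> nat \<Rightarrow> (nat \<Rightarrow> nat) set" where
  "shelf_choices m n = PiE {1..n} (\<lambda>_. {..<2*m+1})"

definition shelf_dist :: "nat \<Rightarrow> nat \<Rightarrow> (nat \<Rightarrow> nat) \<Rightarrow> real" where
  "shelf_dist m n \<pi> =
     real (card {ch \<in> shelf_choices m n. \<forall>i\<in>{1..n}. shelf_deck m n ch ! (i - 1) = \<pi> i})
     / real (2*m+1) ^ n"

definition perms :: "nat \<Rightarrow> (nat \<Rightarrow> nat) set" where
  "perms n = {\<pi>. \<pi> permutes {1..n}}"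

definition linf_dist :: "nat \<Rightarrow> ((nat \<Rightarrow> nat) \<Rightarrow> real) \<Rightarrow> real" where
  "linf_dist n P = Max ((\<lambda>\<pi>. \<bar>1 - fact n * P \<pi>\<bar>) ` perms n)"

definition sep_dist :: "nat \<Rightarrow> ((nat \<Rightarrow> nat) \<Rightarrow> real) \<Rightarrow> real" where
  "sep_dist n P = Max ((\<lambda>\<pi>. 1 - fact n * P \<pi>) ` perms n)"

end

theory Submission
  imports Defs "HOL-Computational_Algebra.Formal_Power_Series" "HOL-Real_Asymp.Real_Asymp"
begin

text \<open>
  The deck produced by choices \<open>ch\<close> is \<open>p\<close> iff the values \<open>ch (p 1), \<dots>, ch (p n)\<close> increase
  weakly, with equality only at even values on ascents of \<open>p\<close> and only at odd values on
  descents. Reading such chains through a transfer matrix that has rank one at every step, the number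
  of choices leading to \<open>p\<close> is the coefficient of \<open>t^m\<close> in
  \<open>(4t)^q (1+t)^(n-2q) / (1-t)^(n+1)\<close>, where \<open>q\<close> is the number of left peaks of \<open>p\<close>. Since
  \<open>(1+t)^2 - 4t = (1-t)^2\<close>, this decreases in \<open>q\<close>: the extremes are the identity (\<open>q = 0\<close>)
  and \<open>2 1 4 3 6 5 \<dots>\<close> (\<open>q = n div 2\<close>).

  With \<open>M = 2m+1\<close> the normalised extreme counts satisfy \<open>b (n+2) = b (n+1) + ((n+1)/M)^2 b n\<close> and
  \<open>a n = (\<Prod>j < n div 2. 1 - ((2j+1)/M)^2)\<close>, so they behave like \<open>exp (n^3 / (3 M^2))\<close> and
  \<open>exp (- n^3 / (6 M^2))\<close>, where \<open>n^3 / M^2\<close> tends to \<open>1 / (4 c^2)\<close>.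
\<close>

section \<open>Choices as chains of values\<close>

text \<open>Cards with choice 2j-1 go on top and so end up reversed, above the cards with choice 2j
  in their original order. Writing \<open>Suc (ch x) = 2 * j\<close> instead of
  \<open>ch x = 2 * j - 1\<close> keeps the first list empty for j = 0 despite truncated
  subtraction.\<close>

lemma shelves_eq_filter:
  "shelves ch k j = rev (filter (\<lambda>x. Suc (ch x) = 2 * j) [1..<Suc k]) @ filter (\<lambda>x. ch x = 2 * j) [1..<Suc k]"
proof (induction k)
  case (Suc k)
  define c where "c = ch (Suc k)"
  have up: "[1..<Suc (Suc k)] = [1..<Suc k] @ [Suc k]" by simp
  have shelves_Suc: "shelves ch (Suc k) j =
      (if Suc c = 2 * j then Suc k # shelves ch k j
       else if c = 2 * j then shelves ch k j @ [Suc k] else shelves ch k j)"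
  proof -
    consider "c = 0" | "odd c" | "even c" "c \<noteq> 0" by blast
    then show ?thesis
    proof cases
      case 1
      then have "Suc c \<noteq> 2 * j" "c = 2 * j \<longleftrightarrow> j = 0" by presburger+
      with 1 show ?thesis by (simp add: c_def Let_def)
    next
      case 2
      then have "c \<noteq> 0" "c \<noteq> 2 * j" "Suc c = 2 * j \<longleftrightarrow> j = (c + 1) div 2" by presburger+
      with 2 show ?thesis by (simp add: c_def Let_def)
    next
      case 3
      then have "Suc c \<noteq> 2 * j" "c = 2 * j \<longleftrightarrow> j = c div 2" by presburger+
      with 3 show ?thesis by (simp add: c_def Let_def)
    qed
  qed
  have "\<not> (Suc c = 2 * j \<and> c = 2 * j)" by simp
  then show ?case
    unfolding shelves_Suc Suc.IH up filter_append by (auto simp: c_def)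
qed simp

text \<open>The order of the cards in the stacked deck: shelf j shows its cards of value 2j-1 above
  those of value 2j, so the values order the deck; ties follow the insertion rule.\<close>

definition deck_less :: "(nat \<Rightarrow> nat) \<Rightarrow> nat \<Rightarrow> nat \<Rightarrow> bool" where
  "deck_less ch x y \<longleftrightarrow> ch x < ch y \<or> ch x = ch y \<and> (if even (ch x) then x < y else y < x)"

lemma deck_less_asym: "deck_less ch x y \<Longrightarrow> \<not> deck_less ch y x"
  unfolding deck_less_def by (metis less_asym)

lemma transp_deck_less: "transp (deck_less ch)"
  unfolding deck_less_def by (rule transpI) (metis less_trans)

text \<open>If the heads differed, each would precede the other. Asymmetry also excludes
  \<open>P x x\<close>, so neither head recurs in its tail and the tails have equal sets.\<close>

lemma sorted_wrt_asym_unique: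
  assumes "\<And>x y. P x y \<Longrightarrow> \<not> P y x"
    and "sorted_wrt P xs" "sorted_wrt P ys" "set xs = set ys"
  shows "xs = ys"
  using assms(2-4)
proof (induction xs arbitrary: ys)
  case (Cons x xs)
  then obtain y ys' where ys: "ys = y # ys'" by (cases ys) auto
  have "x = y" using Cons.prems assms(1) unfolding ys by (metis insert_iff list.simps(15) sorted_wrt.simps(2))
  moreover have "x \<notin> set xs" "y \<notin> set ys'" using Cons.prems assms(1) unfolding ys by (metis sorted_wrt.simps(2))+
  ultimately have "set xs = set ys'" using Cons.prems by (auto simp: ys)
  with Cons \<open>x = y\<close> show ?case by (auto simp: ys)
qed simp

lemma sorted_wrt_concat_map:
  assumes "\<And>i. i \<in> set is \<Longrightarrow> sorted_wrt P (f i)"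
    and "sorted_wrt (\<lambda>i j. \<forall>x\<in>set (f i). \<forall>y\<in>set (f j). P x y) is"
  shows "sorted_wrt P (concat (map f is))"
  using assms by (induction "is") (auto simp: sorted_wrt_append)

lemma sorted_shelf: "sorted_wrt (deck_less ch) (shelves ch n j)"
proof -
  have "sorted_wrt (deck_less ch) (rev (filter (\<lambda>x. Suc (ch x) = 2 * j) [1..<Suc n]))"
    unfolding sorted_wrt_rev
    by (rule sorted_wrt_mono_rel[OF _ sorted_wrt_filter[OF sorted_wrt_upt]])
       (auto simp: deck_less_def simp del: upt_Suc, presburger+)
  moreover have "sorted_wrt (deck_less ch) (filter (\<lambda>x. ch x = 2 * j) [1..<Suc n])"
    by (rule sorted_wrt_mono_rel[OF _ sorted_wrt_filter[OF sorted_wrt_upt]])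
       (auto simp: deck_less_def simp del: upt_Suc)
  ultimately show ?thesis
    unfolding shelves_eq_filter sorted_wrt_append by (auto simp: deck_less_def)
qed

lemma sorted_shelf_deck: "sorted_wrt (deck_less ch) (shelf_deck m n ch)"
  unfolding shelf_deck_def
proof (rule sorted_wrt_concat_map)
  show "sorted_wrt (\<lambda>i j. \<forall>x\<in>set (shelves ch n i). \<forall>y\<in>set (shelves ch n j). deck_less ch x y) [0..<Suc m]"
  proof (rule sorted_wrt_mono_rel[OF _ sorted_wrt_upt], intro ballI)
    fix i j x y assume "i < j" "x \<in> set (shelves ch n i)" "y \<in> set (shelves ch n j)"
    then have "Suc (ch x) = 2 * i \<or> ch x = 2 * i" "Suc (ch y) = 2 * j \<or> ch y = 2 * j"
      by (auto simp: shelves_eq_filter simp del: upt_Suc)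
    with \<open>i < j\<close> have "ch x < ch y" by presburger
    then show "deck_less ch x y" by (simp add: deck_less_def)
  qed
qed (rule sorted_shelf)

lemma set_shelf_deck:
  assumes "ch \<in> shelf_choices m n"
  shows "set (shelf_deck m n ch) = {1..n}"
proof (intro equalityI subsetI)
  fix x assume x: "x \<in> {1..n}"
  then have "ch x < 2 * m + 1" using assms by (auto simp: shelf_choices_def PiE_def Pi_def)
  moreover define j where "j = (if even (ch x) then ch x div 2 else (ch x + 1) div 2)"
  ultimately have "j \<le> m" "Suc (ch x) = 2 * j \<or> ch x = 2 * j"
    by (auto elim!: evenE oddE)
  then show "x \<in> set (shelf_deck m n ch)"
    using x by (auto simp: shelf_deck_def shelves_eq_filter simp del: upt_Suc intro!: bexI[of _ j])
qed (auto simp: shelf_deck_def shelves_eq_filter)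

text \<open>The deck and the list of values of \<open>p\<close> have the same elements, and the deck
  is sorted by \<open>deck_less\<close>. By uniqueness they agree iff the second list is sorted too,
  which by transitivity concerns only neighbours.\<close>

lemma shelf_deck_eq_iff:
  assumes ch: "ch \<in> shelf_choices m n" and p: "p permutes {1..n}"
  shows "(\<forall>i\<in>{1..n}. shelf_deck m n ch ! (i - 1) = p i) \<longleftrightarrow>
         (\<forall>i\<in>{1..<n}. deck_less ch (p i) (p (Suc i)))"
proof -
  let ?D = "shelf_deck m n ch" and ?P = "map p [1..<Suc n]"
  have "distinct ?D"
    using sorted_shelf_deck[of ch m n] deck_less_asym
    by (metis (mono_tags, lifting) distinct_conv_nth linorder_neqE_nat sorted_wrt_iff_nth_less)
  then have len: "length ?D = n"
    using set_shelf_deck[OF ch] distinct_card[of ?D] by simp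
  have setP: "set ?P = {1..n}"
    using permutes_image[OF p] by (simp add: atLeastLessThanSuc_atLeastAtMost del: upt_Suc)
  have "(\<forall>i\<in>{1..n}. ?D ! (i - 1) = p i) \<longleftrightarrow> (\<forall>i<n. ?D ! i = p (Suc i))"
    unfolding image_Suc_lessThan[symmetric] by auto
  also have "\<dots> \<longleftrightarrow> ?D = ?P"
    using len by (auto simp: list_eq_iff_nth_eq simp del: upt_Suc)
  also have "\<dots> \<longleftrightarrow> sorted_wrt (deck_less ch) ?P"
    using sorted_wrt_asym_unique[of "deck_less ch" ?D ?P, OF deck_less_asym sorted_shelf_deck]
      sorted_shelf_deck[of ch m n] setP set_shelf_deck[OF ch] by metis
  also have "\<dots> \<longleftrightarrow> (\<forall>i. Suc i < n \<longrightarrow> deck_less ch (p (Suc i)) (p (Suc (Suc i))))"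
    by (simp add: sorted_wrt_iff_nth_Suc_transp[OF transp_deck_less] del: upt_Suc)
  also have "\<dots> \<longleftrightarrow> (\<forall>i\<in>{1..<n}. deck_less ch (p i) (p (Suc i)))"
    by (auto simp: Suc_le_eq gr0_conv_Suc)
  finally show ?thesis .
qed

section \<open>Counting chains of values\<close>

definition chain_step :: "bool \<Rightarrow> nat \<Rightarrow> nat \<Rightarrow> bool" where
  "chain_step b u v \<longleftrightarrow> u < v \<or> u = v \<and> (even v \<longleftrightarrow> b)"

text \<open>The artificial first value 0 and last value \<open>2m\<close>, joined by ascents, turn the range condition on
  the values into chain steps.\<close>

definition value_chains :: "(nat \<Rightarrow> bool) \<Rightarrow> nat \<Rightarrow> nat \<Rightarrow> (nat \<Rightarrow> nat) set" where
  "value_chains d k v = {a \<in> extensional {0..k}. a 0 = 0 \<and> a k = v \<and> (\<forall>i<k. chain_step (d i) (a i) (a (Suc i)))}"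

fun chain_count :: "(nat \<Rightarrow> bool) \<Rightarrow> nat \<Rightarrow> nat \<Rightarrow> nat" where
  "chain_count d 0 v = (if v = 0 then 1 else 0)"
| "chain_count d (Suc k) v =
     (\<Sum>u<v. chain_count d k u) + (if even v = d k then chain_count d k v else 0)"

lemma value_chains_0: "value_chains d 0 v = (if v = 0 then {\<lambda>i. if i = 0 then 0 else undefined} else {})"
  by (auto simp: value_chains_def extensional_def)

lemma value_chains_Suc:
  "value_chains d (Suc k) v = (\<Union>u\<in>{u. chain_step (d k) u v}. (\<lambda>a. a(Suc k := v)) ` value_chains d k u)"
proof (intro equalityI subsetI)
  fix a assume a: "a \<in> value_chains d (Suc k) v"
  let ?b = "restrict a {0..k}"
  have "?b \<in> value_chains d k (a k)" using a by (auto simp: value_chains_def)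
  moreover have "chain_step (d k) (a k) v" using a by (auto simp: value_chains_def)
  moreover have "a = ?b(Suc k := v)"
    using a by (auto simp: value_chains_def extensional_def fun_eq_iff)
  ultimately show "a \<in> (\<Union>u\<in>{u. chain_step (d k) u v}. (\<lambda>a. a(Suc k := v)) ` value_chains d k u)"
    by blast
next
  fix a assume "a \<in> (\<Union>u\<in>{u. chain_step (d k) u v}. (\<lambda>a. a(Suc k := v)) ` value_chains d k u)"
  then show "a \<in> value_chains d (Suc k) v"
    by (auto simp: value_chains_def extensional_def less_Suc_eq)
qed

lemma chain_step_set: "{u. chain_step b u v} = {..<v} \<union> (if even v = b then {v} else {})"
  by (auto simp: chain_step_def)

lemma card_value_chains: "finite (value_chains d k v) \<and> card (value_chains d k v) = chain_count d k v"
proof (induction k arbitrary: v)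
  case 0
  then show ?case by (simp add: value_chains_0)
next
  case (Suc k)
  let ?I = "{u. chain_step (d k) u v}" and ?f = "\<lambda>a. a(Suc k := v)"
  have fin: "finite ?I" by (simp add: chain_step_set)
  have inj: "inj_on ?f (value_chains d k u)" for u
  proof (rule inj_onI)
    fix a b assume ab: "a \<in> value_chains d k u" "b \<in> value_chains d k u" and eq: "?f a = ?f b"
    have "a i = b i" for i
      using fun_cong[OF eq, of i] ab by (cases "i = Suc k") (auto simp: value_chains_def extensional_def)
    then show "a = b" by blast
  qed
  \<comment> \<open>The update at \<open>Suc k\<close> leaves \<open>a k = u\<close> untouched, so
    the penultimate value tells the images apart.\<close>
  have disj: "?f ` value_chains d k u \<inter> ?f ` value_chains d k u' = {}" if "u \<noteq> u'" for u u'
  proof -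
    have "a k = u" if "a \<in> ?f ` value_chains d k u" for a u using that by (auto simp: value_chains_def)
    then show ?thesis using that by blast
  qed
  have "card (value_chains d (Suc k) v) = (\<Sum>u\<in>?I. card (?f ` value_chains d k u))"
    unfolding value_chains_Suc using fin Suc disj by (intro card_UN_disjoint) auto
  also have "\<dots> = (\<Sum>u\<in>?I. chain_count d k u)"
    using Suc card_image[OF inj] by simp
  also have "\<dots> = chain_count d (Suc k) v"
    by (simp add: chain_step_set)
  finally show ?case using fin Suc by (simp add: value_chains_Suc)
qed

text \<open>The artificial positions 0 and n must be ascents: 0 and 2m are even, so an ascent step
  from 0 or to 2m is exactly a weak inequality.\<close>

definition ascent_at :: "nat \<Rightarrow> (nat \<Rightarrow> nat) \<Rightarrow> nat \<Rightarrow> bool" where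
  "ascent_at n p i \<longleftrightarrow> i = 0 \<or> i = n \<or> p i < p (Suc i)"

lemma deck_less_iff_chain_step:
  assumes "p permutes {1..n}" "i \<in> {1..<n}"
  shows "deck_less ch (p i) (p (Suc i)) \<longleftrightarrow> chain_step (ascent_at n p i) (ch (p i)) (ch (p (Suc i)))"
proof -
  have "p i \<noteq> p (Suc i)" using permutes_inj[OF assms(1)] by (metis injD n_not_Suc_n)
  then show ?thesis using assms(2) by (auto simp: deck_less_def chain_step_def ascent_at_def)
qed

text \<open>A bijection: \<open>F\<close> reads the choices in deck order and attaches the two
  artificial end values; \<open>H\<close> drops them and reads back through
  \<open>inv p\<close>.\<close>

lemma card_shelf_choices_eq:
  assumes p: "p permutes {1..n}"
  shows "card {ch \<in> shelf_choices m n. \<forall>i\<in>{1..n}. shelf_deck m n ch ! (i - 1) = p i} =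
         chain_count (ascent_at n p) (Suc n) (2 * m)"
proof -
  let ?d = "ascent_at n p"
  let ?A = "{ch \<in> shelf_choices m n. \<forall>i\<in>{1..<n}. chain_step (?d i) (ch (p i)) (ch (p (Suc i)))}"
  define F where "F ch = (\<lambda>i. if i = 0 then 0 else if i \<le> n then ch (p i)
      else if i = Suc n then 2 * m else undefined)" for ch :: "nat \<Rightarrow> nat"
  define H where "H a = restrict (\<lambda>x. a (inv p x)) {1..n}" for a :: "nat \<Rightarrow> nat"
  have pi: "p i \<in> {1..n} \<longleftrightarrow> i \<in> {1..n}" for i using permutes_in_image[OF p] .
  have ip: "inv p i \<in> {1..n} \<longleftrightarrow> i \<in> {1..n}" for i
    using permutes_in_image[OF permutes_inv[OF p]] .
  note inv = permutes_inverses[OF p]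
  have "bij_betw F ?A (value_chains ?d (Suc n) (2 * m))"
  proof (rule bij_betw_byWitness[where f' = H])
    show "\<forall>ch\<in>?A. H (F ch) = ch"
    proof
      fix ch assume "ch \<in> ?A"
      then have "ch \<in> extensional {1..n}" by (auto simp: shelf_choices_def PiE_def)
      then have "H (F ch) x = ch x" for x
        using ip[of x] inv by (cases "x \<in> {1..n}") (auto simp: H_def F_def extensional_def)
      then show "H (F ch) = ch" ..
    qed
    show "\<forall>a\<in>value_chains ?d (Suc n) (2 * m). F (H a) = a"
    proof
      fix a assume a: "a \<in> value_chains ?d (Suc n) (2 * m)"
      have "F (H a) i = a i" for i
      proof (cases "i \<in> {1..n}")
        case True
        then show ?thesis using pi[of i] inv by (simp add: F_def H_def)
      next
        case False
        then show ?thesis using a by (auto simp: F_def value_chains_def extensional_def)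
      qed
      then show "F (H a) = a" ..
    qed
    show "F ` ?A \<subseteq> value_chains ?d (Suc n) (2 * m)"
    proof safe
      fix ch assume ch: "ch \<in> shelf_choices m n"
        and st: "\<forall>i\<in>{1..<n}. chain_step (?d i) (ch (p i)) (ch (p (Suc i)))"
      have le: "ch (p i) \<le> 2 * m" if "i \<in> {1..n}" for i
        using ch that pi[of i] by (fastforce simp: shelf_choices_def PiE_def Pi_def)
      have "chain_step (?d i) (F ch i) (F ch (Suc i))" if i: "i < Suc n" for i
      proof -
        consider "i = 0" | "i = n" "i \<noteq> 0" | "i \<in> {1..<n}" using i by force
        then show ?thesis
        proof cases
          case 1
          then show ?thesis by (auto simp: F_def chain_step_def ascent_at_def)
        next
          case 2
          then show ?thesis using le[of i] by (auto simp: F_def chain_step_def ascent_at_def)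
        next
          case 3
          then show ?thesis using st by (auto simp: F_def)
        qed
      qed
      then show "F ch \<in> value_chains ?d (Suc n) (2 * m)"
        by (auto simp: value_chains_def F_def extensional_def)
    qed
    show "H ` value_chains ?d (Suc n) (2 * m) \<subseteq> ?A"
    proof safe
      fix a assume "a \<in> value_chains ?d (Suc n) (2 * m)"
      then have last: "a (Suc n) = 2 * m"
        and st: "\<And>i. i < Suc n \<Longrightarrow> chain_step (?d i) (a i) (a (Suc i))"
        by (auto simp: value_chains_def)
      \<comment> \<open>Chains increase weakly, so the final value 2m bounds every choice.\<close>
      have "a i \<le> a (Suc n)" if "i \<le> Suc n" for i
        using that
      proof (induction rule: inc_induct)
        case (step k)
        then show ?case using st[of k] by (auto simp: chain_step_def)
      qed simp
      then have "a (inv p x) < 2 * m + 1" if "x \<in> {1..n}" for x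
        using that ip[of x] last by (auto simp: less_Suc_eq_le)
      then show "H a \<in> shelf_choices m n"
        by (auto simp: H_def shelf_choices_def)
      fix i assume i: "i \<in> {1..<n}"
      then have "H a (p i) = a i" "H a (p (Suc i)) = a (Suc i)"
        using pi[of i] pi[of "Suc i"] inv by (auto simp: H_def)
      then show "chain_step (?d i) (H a (p i)) (H a (p (Suc i)))"
        using st[of i] i by simp
    qed
  qed
  then have "card ?A = card (value_chains ?d (Suc n) (2 * m))" by (rule bij_betw_same_card)
  also have "\<dots> = chain_count ?d (Suc n) (2 * m)" using card_value_chains by blast
  finally have "card ?A = chain_count ?d (Suc n) (2 * m)" .
  moreover have "{ch \<in> shelf_choices m n. \<forall>i\<in>{1..n}. shelf_deck m n ch ! (i - 1) = p i} = ?A"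
  proof (intro Collect_cong conj_cong refl)
    fix ch assume "ch \<in> shelf_choices m n"
    from shelf_deck_eq_iff[OF this p]
    show "(\<forall>i\<in>{1..n}. shelf_deck m n ch ! (i - 1) = p i) \<longleftrightarrow>
      (\<forall>i\<in>{1..<n}. chain_step (?d i) (ch (p i)) (ch (p (Suc i))))"
      using deck_less_iff_chain_step[OF p] by (simp only: cong: ball_cong)
  qed
  ultimately show ?thesis by (simp only:)
qed

section \<open>Generating functions\<close>

definition geo :: "real fps" where "geo = Abs_fps (\<lambda>_. 1)"

lemma geo_mult: "(1 - fps_X) * geo = 1"
  by (simp add: fps_eq_iff geo_def left_diff_distrib)

lemma geo_cancel: "(1 - fps_X) * f = g \<Longrightarrow> f = geo * g"
proof -
  assume "(1 - fps_X) * f = g"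
  then have "geo * g = ((1 - fps_X) * geo) * f" by (simp add: mult_ac)
  then show "f = geo * g" by (simp add: geo_mult)
qed

lemma deriv_geo: "fps_deriv geo = geo ^ 2"
proof -
  have "fps_deriv ((1 - fps_X) * geo) = 0" by (simp add: geo_mult)
  then have "(1 - fps_X) * fps_deriv geo = geo" by (simp add: algebra_simps)
  from geo_cancel[OF this] show ?thesis by (simp add: power2_eq_square)
qed

text \<open>Parity decides whether a value may be repeated, hence two series. The exponent is the
  shelf number: shelf s owns the values 2s-1 and 2s.\<close>

definition even_gf :: "(nat \<Rightarrow> bool) \<Rightarrow> nat \<Rightarrow> real fps" where
  "even_gf d k = Abs_fps (\<lambda>s. real (chain_count d k (2 * s)))"

text \<open>Shelf 0 has no odd value; without the case split, truncated subtraction would count the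
  value 0 here.\<close>

definition odd_gf :: "(nat \<Rightarrow> bool) \<Rightarrow> nat \<Rightarrow> real fps" where
  "odd_gf d k = Abs_fps (\<lambda>s. if s = 0 then 0 else real (chain_count d k (2 * s - 1)))"

lemma gf_0: "even_gf d 0 = 1" "odd_gf d 0 = 0"
  by (auto simp: even_gf_def odd_gf_def fps_eq_iff)

text \<open>Multiplication by \<open>1 - fps_X\<close> takes differences between consecutive
  shelves. At an ascent, 2s has the predecessors up to 2s, so the difference keeps 2s-1 and 2s; 2s-1
  has the same predecessors as 2(s-1).\<close>

lemma gf_ascent:
  assumes "d k"
  shows "even_gf d (Suc k) = geo * (even_gf d k + odd_gf d k)" "odd_gf d (Suc k) = fps_X * even_gf d (Suc k)"
proof -
  have "(1 - fps_X) * even_gf d (Suc k) = even_gf d k + odd_gf d k"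
  proof (rule fps_ext)
    fix s show "fps_nth ((1 - fps_X) * even_gf d (Suc k)) s = fps_nth (even_gf d k + odd_gf d k) s"
      using assms by (cases s) (simp_all add: left_diff_distrib even_gf_def odd_gf_def)
  qed
  then show "even_gf d (Suc k) = geo * (even_gf d k + odd_gf d k)" by (rule geo_cancel)
  show "odd_gf d (Suc k) = fps_X * even_gf d (Suc k)"
  proof (rule fps_ext)
    fix s show "fps_nth (odd_gf d (Suc k)) s = fps_nth (fps_X * even_gf d (Suc k)) s"
      using assms by (cases s) (simp_all add: even_gf_def odd_gf_def)
  qed
qed

text \<open>At a descent both 2s and 2s-1 have the predecessors up to 2s-1, so the two series
  coincide, and the difference keeps 2s-2 and 2s-1.\<close>

lemma gf_descent:
  assumes "\<not> d k"
  shows "even_gf d (Suc k) = geo * (fps_X * even_gf d k + odd_gf d k)" "odd_gf d (Suc k) = even_gf d (Suc k)"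
proof -
  have "(1 - fps_X) * even_gf d (Suc k) = fps_X * even_gf d k + odd_gf d k"
  proof (rule fps_ext)
    fix s show "fps_nth ((1 - fps_X) * even_gf d (Suc k)) s = fps_nth (fps_X * even_gf d k + odd_gf d k) s"
      using assms by (cases s) (simp_all add: left_diff_distrib even_gf_def odd_gf_def)
  qed
  then show "even_gf d (Suc k) = geo * (fps_X * even_gf d k + odd_gf d k)" by (rule geo_cancel)
  show "odd_gf d (Suc k) = even_gf d (Suc k)"
  proof (rule fps_ext)
    fix s show "fps_nth (odd_gf d (Suc k)) s = fps_nth (even_gf d (Suc k)) s"
      using assms by (cases s) (simp_all add: even_gf_def odd_gf_def)
  qed
qed

text \<open>A descent at \<open>Suc k\<close> after an ascent at \<open>k\<close>; the artificial ascent at 0 makes these left peaks.\<close>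

fun peaks :: "(nat \<Rightarrow> bool) \<Rightarrow> nat \<Rightarrow> nat" where
  "peaks d 0 = 0"
| "peaks d (Suc k) = peaks d k + (if d k \<and> \<not> d (Suc k) then 1 else 0)"

text \<open>The pair of generating functions always lies on one of two lines, according to the last step,
  so every step acts as multiplication by a scalar.\<close>

lemma gf_chains:
  assumes "d 0"
  shows "2 * peaks d k \<le> k + (if d k then 0 else 1) \<and>
    (if d k then even_gf d (Suc k) = (4 * fps_X) ^ peaks d k * (1 + fps_X) ^ (k - 2 * peaks d k) * geo ^ Suc k
            \<and> odd_gf d (Suc k) = fps_X * even_gf d (Suc k)
     else peaks d k > 0 \<and>
       even_gf d (Suc k) = 2 * fps_X * (4 * fps_X) ^ (peaks d k - 1) * (1 + fps_X) ^ (k + 1 - 2 * peaks d k) * geo ^ Suc k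
            \<and> odd_gf d (Suc k) = even_gf d (Suc k))"
proof (induction k)
  case 0
  then show ?case using assms gf_ascent[of d 0] by (simp add: gf_0)
next
  case (Suc k)
  define q where "q = peaks d k"
  show ?case
  proof (cases "d k")
    case True
    define r where "r = k - 2 * q"
    have k: "k = 2 * q + r" using Suc True by (simp add: q_def r_def)
    define Y :: "real fps" where "Y = (4 * fps_X) ^ q * (1 + fps_X) ^ r * geo ^ Suc k"
    have IH: "even_gf d (Suc k) = Y" "odd_gf d (Suc k) = fps_X * Y"
      using Suc True by (simp_all add: q_def r_def Y_def)
    show ?thesis
    proof (cases "d (Suc k)")
      case d: True
      \<comment> \<open>Ascent after ascent: the scalar is (1+t)/(1-t).\<close>
      have "even_gf d (Suc (Suc k)) = geo * (Y + fps_X * Y)"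
        using gf_ascent[of d "Suc k"] d IH by simp
      also have "\<dots> = (4 * fps_X) ^ q * (1 + fps_X) ^ Suc r * geo ^ Suc (Suc k)"
        by (simp add: Y_def algebra_simps)
      moreover have "peaks d (Suc k) = q" using d by (simp add: q_def)
      moreover have "Suc k - 2 * q = Suc r" "2 * q \<le> Suc k" using k by simp_all
      ultimately show ?thesis using d gf_ascent(2)[of d "Suc k"] by (simp only: simp_thms if_True add_0_right)
    next
      case d: False
      \<comment> \<open>Descent after ascent: the scalar is 2t/(1-t). The new left peak stays half
        finished, which is why the descent case of the claim carries \<open>2 * fps_X\<close> and
        one power of \<open>4 * fps_X\<close> less.\<close>
      have "even_gf d (Suc (Suc k)) = geo * (fps_X * Y + fps_X * Y)"
        using gf_descent[of d "Suc k"] d IH by simp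
      also have "\<dots> = 2 * fps_X * (4 * fps_X) ^ q * (1 + fps_X) ^ r * geo ^ Suc (Suc k)"
        by (simp add: Y_def algebra_simps)
      moreover have "peaks d (Suc k) = Suc q" using d True by (simp add: q_def)
      moreover have "Suc k + 1 - 2 * Suc q = r" "2 * Suc q \<le> Suc k + 1" "Suc q - 1 = q" "0 < Suc q"
        using k by simp_all
      ultimately show ?thesis using d gf_descent(2)[of d "Suc k"] by (simp only: simp_thms if_False)
    qed
  next
    case False
    define r where "r = k + 1 - 2 * q"
    have k: "Suc k = 2 * q + r" and "q > 0" using Suc False by (simp_all add: q_def r_def)
    then obtain q' where q': "q = Suc q'" by (cases q) auto
    define Y :: "real fps" where "Y = 2 * fps_X * (4 * fps_X) ^ q' * (1 + fps_X) ^ r * geo ^ Suc k"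
    have IH: "even_gf d (Suc k) = Y" "odd_gf d (Suc k) = Y"
      using Suc False q' by (simp_all add: q_def[symmetric] r_def Y_def)
    show ?thesis
    proof (cases "d (Suc k)")
      case d: True
      \<comment> \<open>Ascent after descent: the scalar 2/(1-t) completes the pending
        \<open>2 * fps_X\<close> to \<open>4 * fps_X\<close>.\<close>
      have "even_gf d (Suc (Suc k)) = geo * (Y + Y)"
        using gf_ascent[of d "Suc k"] d IH by simp
      also have "\<dots> = (4 * fps_X) ^ q * (1 + fps_X) ^ r * geo ^ Suc (Suc k)"
        by (simp add: Y_def q' algebra_simps)
      moreover have "peaks d (Suc k) = q" using False by (simp add: q_def)
      moreover have "Suc k - 2 * q = r" "2 * q \<le> Suc k" using k by simp_all
      ultimately show ?thesis using d gf_ascent(2)[of d "Suc k"] by (simp only: simp_thms if_True add_0_right)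
    next
      case d: False
      have "even_gf d (Suc (Suc k)) = geo * (fps_X * Y + Y)"
        using gf_descent[of d "Suc k"] d IH by simp
      also have "\<dots> = 2 * fps_X * (4 * fps_X) ^ q' * (1 + fps_X) ^ Suc r * geo ^ Suc (Suc k)"
        by (simp add: Y_def algebra_simps)
      moreover have "peaks d (Suc k) = q" using False by (simp add: q_def)
      moreover have "Suc k + 1 - 2 * q = Suc r" "2 * q \<le> Suc k + 1" "q - 1 = q'"
        using k q' by simp_all
      ultimately show ?thesis using d gf_descent(2)[of d "Suc k"] \<open>q > 0\<close> by (simp only: simp_thms if_False)
    qed
  qed
qed

definition peak_gf :: "nat \<Rightarrow> nat \<Rightarrow> real fps" where
  "peak_gf n p = (4 * fps_X) ^ p * (1 + fps_X) ^ (n - 2 * p) * geo ^ Suc n"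

lemma chain_count_eq_peak_gf:
  assumes "d 0" "d n"
  shows "real (chain_count d (Suc n) (2 * m)) = fps_nth (peak_gf n (peaks d n)) m" "2 * peaks d n \<le> n"
proof -
  have "real (chain_count d (Suc n) (2 * m)) = fps_nth (even_gf d (Suc n)) m" by (simp only: even_gf_def fps_nth_Abs_fps)
  then show "real (chain_count d (Suc n) (2 * m)) = fps_nth (peak_gf n (peaks d n)) m" "2 * peaks d n \<le> n"
    using gf_chains[of d n] assms by (simp_all add: peak_gf_def)
qed

section \<open>Monotonicity of the coefficients in the number of peaks\<close>

definition fps_nonneg :: "real fps \<Rightarrow> bool" where "fps_nonneg f \<longleftrightarrow> (\<forall>i. 0 \<le> fps_nth f i)"

lemma fps_nonneg_mult: "fps_nonneg f \<Longrightarrow> fps_nonneg g \<Longrightarrow> fps_nonneg (f * g)"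
  by (auto simp: fps_nonneg_def fps_mult_nth intro!: sum_nonneg mult_nonneg_nonneg)

lemma fps_nonneg_power: "fps_nonneg f \<Longrightarrow> fps_nonneg (f ^ k)"
  by (induction k) (auto simp: fps_nonneg_mult, simp add: fps_nonneg_def)

lemma fps_nonneg_base: "fps_nonneg (4 * fps_X)" "fps_nonneg (1 + fps_X)" "fps_nonneg geo"
  by (auto simp: fps_nonneg_def geo_def fps_X_def numeral_fps_const)

text \<open>One more peak replaces \<open>(1 + fps_X) ^ 2\<close> by \<open>4 * fps_X\<close>. The
  difference of these is \<open>(1 - fps_X) ^ 2\<close>, which cancels two factors
  \<open>geo\<close>; what remains has nonnegative coefficients.\<close>

lemma peak_gf_Suc:
  assumes "2 * Suc p \<le> n"
  shows "peak_gf n p - peak_gf n (Suc p) = (4 * fps_X) ^ p * (1 + fps_X) ^ (n - 2 * Suc p) * geo ^ (n - 1)"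
proof -
  define r where "r = n - 2 * Suc p"
  have n: "n = 2 * p + r + 2" using assms by (simp add: r_def)
  define A :: "real fps" where "A = (4 * fps_X) ^ p * (1 + fps_X) ^ r * geo ^ (n - 1)"
  have "peak_gf n p = A * (1 + fps_X) ^ 2 * geo ^ 2"
    by (simp add: peak_gf_def A_def n power_add power2_eq_square mult_ac)
  moreover have "peak_gf n (Suc p) = A * (4 * fps_X) * geo ^ 2"
    by (simp add: peak_gf_def A_def n power_add power2_eq_square mult_ac)
  ultimately have "peak_gf n p - peak_gf n (Suc p) = A * ((1 - fps_X) * geo) ^ 2"
    by (simp add: power2_eq_square algebra_simps)
  then show ?thesis by (simp add: geo_mult A_def r_def)
qed

lemma peak_gf_antimono:
  assumes "p \<le> q" "2 * q \<le> n"
  shows "fps_nth (peak_gf n q) m \<le> fps_nth (peak_gf n p) m"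
  using assms
proof (induction rule: dec_induct)
  case (step k)
  have "fps_nonneg (peak_gf n k - peak_gf n (Suc k))"
    unfolding peak_gf_Suc[OF step.prems]
    by (intro fps_nonneg_mult fps_nonneg_power fps_nonneg_base)
  then have "fps_nth (peak_gf n (Suc k)) m \<le> fps_nth (peak_gf n k) m" by (simp add: fps_nonneg_def)
  with step show ?case by simp
qed simp

section \<open>A differential operator and recurrences in the deck size\<close>

definition odd_euler :: "real fps \<Rightarrow> real fps" where
  "odd_euler f = 2 * fps_X * fps_deriv f + f"

lemma odd_euler_nth: "fps_nth (odd_euler f) m = real (2 * m + 1) * fps_nth f m"
  by (cases m) (simp_all add: odd_euler_def numeral_fps_const mult.assoc algebra_simps)

lemma fps_deriv_power_Suc:
  "fps_deriv (f ^ Suc k) = of_nat (Suc k) * fps_deriv f * (f :: real fps) ^ k"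
  using fps_deriv_power'[of f "Suc k"] by (simp only: diff_Suc_1)

lemma deriv_geo_power: "fps_deriv (geo ^ k) = of_nat k * geo ^ Suc k"
proof (cases k)
  case (Suc j)
  show ?thesis
    unfolding Suc fps_deriv_power_Suc deriv_geo by (simp only: power2_eq_square power_Suc mult_ac)
qed simp

lemma X_deriv_monomial: "fps_X * fps_deriv ((4 * fps_X) ^ p) = of_nat p * (4 * fps_X :: real fps) ^ p"
proof (cases p)
  case (Suc j)
  have "fps_deriv (4 * fps_X :: real fps) = 4" by simp
  then show ?thesis
    unfolding Suc fps_deriv_power_Suc by (simp only: power_Suc mult_ac)
qed simp

lemma geo_power: "geo ^ k = (1 - fps_X) * geo ^ Suc k"
  by (simp add: geo_mult flip: mult.assoc)

text \<open>As \<^const>\<open>odd_euler\<close> has the eigenvalue \<open>M = 2m+1\<close> on \<open>t^m\<close>, the following identities are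
  recurrences in \<open>n\<close> for the coefficients at a fixed \<open>m\<close>.\<close>

lemma odd_euler_identity_gf:
  "odd_euler (peak_gf (Suc n) 0) = of_nat (Suc (Suc n)) * peak_gf (Suc (Suc n)) 0 - of_nat (Suc n) * peak_gf n 0"
proof -
  define S where "S = (1 + fps_X :: real fps)"
  \<comment> \<open>\<open>R\<close> carries the highest power of \<open>geo\<close> that occurs. As
    multiples of \<open>R\<close>, all terms reduce the claim to an identity of polynomials.\<close>
  define R where "R = S ^ n * geo ^ Suc (Suc (Suc n))"
  have d: "fps_deriv (S ^ Suc n) = of_nat (Suc n) * S ^ n"
    unfolding fps_deriv_power_Suc by (simp add: S_def)
  have g2: "geo ^ Suc (Suc n) = (1 - fps_X) * geo ^ Suc (Suc (Suc n))"
    by (rule geo_power)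
  have g1: "geo ^ Suc n = (1 - fps_X) * ((1 - fps_X) * geo ^ Suc (Suc (Suc n)))"
    by (metis geo_power)
  have p2: "peak_gf (Suc (Suc n)) 0 = S ^ 2 * R"
    by (simp add: peak_gf_def R_def S_def power2_eq_square mult_ac)
  have p1: "peak_gf (Suc n) 0 = S ^ Suc n * geo ^ Suc (Suc n)"
    by (simp add: peak_gf_def S_def)
  have p1': "peak_gf (Suc n) 0 = S * (1 - fps_X) * R"
    unfolding p1 g2 by (simp add: R_def mult_ac)
  have p0: "peak_gf n 0 = (1 - fps_X) ^ 2 * R"
  proof -
    have "peak_gf n 0 = S ^ n * geo ^ Suc n" by (simp add: peak_gf_def S_def)
    then show ?thesis unfolding g1 by (simp add: R_def power2_eq_square mult_ac)
  qed
  have "fps_deriv (peak_gf (Suc n) 0) = of_nat (Suc n) * S ^ n * geo ^ Suc (Suc n)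
      + of_nat (Suc (Suc n)) * S ^ Suc n * geo ^ Suc (Suc (Suc n))"
    unfolding p1 fps_deriv_mult d deriv_geo_power by (simp only: mult_ac add_ac)
  also have "\<dots> = (of_nat (Suc n) * (1 - fps_X) + of_nat (Suc (Suc n)) * S) * R"
    unfolding g2 by (simp only: R_def power_Suc ring_distribs mult_ac)
  finally have D: "fps_deriv (peak_gf (Suc n) 0) = (of_nat (Suc n) * (1 - fps_X) + of_nat (Suc (Suc n)) * S) * R" .
  show ?thesis
    unfolding odd_euler_def D unfolding p1' p2 p0 unfolding S_def
    by (simp add: power2_eq_square algebra_simps)
qed

text \<open>After factoring out \<open>R\<close>, the operator yields (2p+1)(1-t) + 2(2p+1)t =
  (2p+1)(1+t), and 1+t is the factor that the next series has in addition.\<close>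

lemma odd_euler_even_peaks:
  "odd_euler (peak_gf (2 * p) p) = of_nat (2 * p + 1) * peak_gf (2 * p + 1) p"
proof -
  define R :: "real fps" where "R = (4 * fps_X) ^ p * geo ^ (2 * p + 2)"
  have g: "geo ^ (2 * p + 1) = (1 - fps_X) * geo ^ (2 * p + 2)"
    using geo_power[of "2 * p + 1"] by simp
  have p0: "peak_gf (2 * p) p = (4 * fps_X) ^ p * geo ^ (2 * p + 1)"
    by (simp add: peak_gf_def)
  have p0': "peak_gf (2 * p) p = (1 - fps_X) * R"
    unfolding p0 g by (simp only: R_def mult_ac)
  have p1: "peak_gf (2 * p + 1) p = (1 + fps_X) * R"
    by (simp add: peak_gf_def R_def mult_ac)
  have dg: "fps_deriv (geo ^ (2 * p + 1)) = of_nat (2 * p + 1) * geo ^ (2 * p + 2)"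
    using deriv_geo_power[of "2 * p + 1"] by simp
  have "fps_X * fps_deriv (peak_gf (2 * p) p) =
     fps_X * fps_deriv ((4 * fps_X) ^ p) * geo ^ (2 * p + 1) + fps_X * (4 * fps_X) ^ p * fps_deriv (geo ^ (2 * p + 1))"
    unfolding p0 fps_deriv_mult by (simp only: ring_distribs mult_ac add_ac)
  also have "\<dots> = of_nat p * (1 - fps_X) * R + of_nat (2 * p + 1) * fps_X * R"
    unfolding X_deriv_monomial dg unfolding g by (simp only: R_def mult_ac)
  finally have "odd_euler (peak_gf (2 * p) p) = 2 * (of_nat p * (1 - fps_X) * R + of_nat (2 * p + 1) * fps_X * R) + (1 - fps_X) * R"
    unfolding odd_euler_def mult.assoc p0'[symmetric] by simp
  then show ?thesis unfolding p1 by (simp add: algebra_simps)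
qed

text \<open>Over the common factor \<open>R\<close> this is a quadratic polynomial identity. With
  the preceding lemma it advances the series of maximal peak number from 2p to 2p+2 cards.\<close>

lemma odd_euler_odd_peaks:
  "odd_euler (peak_gf (2 * p + 1) p) = of_nat (2 * p + 2) * peak_gf (2 * p + 2) (p + 1) + of_nat (2 * p + 1) * peak_gf (2 * p) p"
proof -
  define R :: "real fps" where "R = (4 * fps_X) ^ p * geo ^ (2 * p + 3)"
  have g2: "geo ^ (2 * p + 2) = (1 - fps_X) * geo ^ (2 * p + 3)"
    using geo_power[of "2 * p + 2"] by (simp add: eval_nat_numeral)
  have g1: "geo ^ (2 * p + 1) = (1 - fps_X) * ((1 - fps_X) * geo ^ (2 * p + 3))"
    unfolding g2[symmetric] using geo_power[of "2 * p + 1"] by simp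
  have p0: "peak_gf (2 * p) p = (1 - fps_X) ^ 2 * R"
  proof -
    have "peak_gf (2 * p) p = (4 * fps_X) ^ p * geo ^ (2 * p + 1)" by (simp add: peak_gf_def)
    then show ?thesis unfolding g1 by (simp only: R_def power2_eq_square mult_ac)
  qed
  have p1: "peak_gf (2 * p + 1) p = (4 * fps_X) ^ p * ((1 + fps_X) * geo ^ (2 * p + 2))"
    by (simp add: peak_gf_def mult_ac)
  have p1': "peak_gf (2 * p + 1) p = (1 + fps_X) * (1 - fps_X) * R"
    unfolding p1 g2 by (simp only: R_def mult_ac)
  have p2: "peak_gf (2 * p + 2) (p + 1) = 4 * fps_X * R"
    by (simp add: peak_gf_def R_def mult_ac eval_nat_numeral)
  have dg: "fps_deriv (geo ^ (2 * p + 2)) = of_nat (2 * p + 2) * geo ^ (2 * p + 3)"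
    using deriv_geo_power[of "2 * p + 2"] by (simp add: eval_nat_numeral)
  have ds: "fps_deriv (1 + fps_X) = (1 :: real fps)" by simp
  have "fps_X * fps_deriv (peak_gf (2 * p + 1) p) =
     (fps_X * fps_deriv ((4 * fps_X) ^ p)) * (1 + fps_X) * geo ^ (2 * p + 2)
     + fps_X * (4 * fps_X) ^ p * geo ^ (2 * p + 2)
     + fps_X * (4 * fps_X) ^ p * (1 + fps_X) * fps_deriv (geo ^ (2 * p + 2))"
    unfolding p1 fps_deriv_mult ds by (simp add: algebra_simps)
  also have "\<dots> = of_nat p * (1 + fps_X) * (1 - fps_X) * R + fps_X * (1 - fps_X) * R + of_nat (2 * p + 2) * fps_X * (1 + fps_X) * R"
    unfolding X_deriv_monomial dg unfolding g2 by (simp only: R_def mult_ac)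
  finally have "odd_euler (peak_gf (2 * p + 1) p) = 2 * (of_nat p * (1 + fps_X) * (1 - fps_X) * R + fps_X * (1 - fps_X) * R
       + of_nat (2 * p + 2) * fps_X * (1 + fps_X) * R) + (1 + fps_X) * (1 - fps_X) * R"
    unfolding odd_euler_def mult.assoc p1' by simp
  then show ?thesis unfolding p0 p2 by (simp add: algebra_simps power2_eq_square)
qed

section \<open>Extremal permutations\<close>

text \<open>The density, relative to the uniform distribution, of a permutation with
  \<open>q\<close> left peaks.\<close>

definition peak_density :: "nat \<Rightarrow> nat \<Rightarrow> nat \<Rightarrow> real" where
  "peak_density m n q = fact n * fps_nth (peak_gf n q) m / real (2 * m + 1) ^ n"

lemma shelf_dist_eq_peak_density:
  assumes "p permutes {1..n}"
  shows "fact n * shelf_dist m n p = peak_density m n (peaks (ascent_at n p) n)"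
    and "2 * peaks (ascent_at n p) n \<le> n"
proof -
  have d: "ascent_at n p 0" "ascent_at n p n" by (simp_all add: ascent_at_def)
  show "fact n * shelf_dist m n p = peak_density m n (peaks (ascent_at n p) n)"
    unfolding shelf_dist_def card_shelf_choices_eq[OF assms] peak_density_def
      chain_count_eq_peak_gf(1)[of "ascent_at n p", OF d] by simp
  show "2 * peaks (ascent_at n p) n \<le> n"
    using chain_count_eq_peak_gf(2)[of "ascent_at n p", OF d] .
qed

lemma peak_density_antimono:
  "p \<le> q \<Longrightarrow> 2 * q \<le> n \<Longrightarrow> peak_density m n q \<le> peak_density m n p"
  unfolding peak_density_def by (intro divide_right_mono mult_left_mono peak_gf_antimono) auto

lemma peaks_id: "peaks (ascent_at n id) k = 0"
  by (induction k) (auto simp: ascent_at_def)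

text \<open>The permutation 2 1 4 3 ..., with the last card fixed when n is odd; it reaches the
  largest possible number of left peaks.\<close>

definition pair_swap :: "nat \<Rightarrow> nat \<Rightarrow> nat" where
  "pair_swap n i = (if i = 0 \<or> n < i then i else if even i then i - 1 else if i < n then i + 1 else i)"

lemma pair_swap_permutes: "pair_swap n permutes {1..n}"
proof (rule bij_imp_permutes)
  have inv: "pair_swap n (pair_swap n i) = i" for i
    by (cases "i = 0 \<or> n < i"; cases "even i"; cases "i < n") (auto simp: pair_swap_def)
  have range: "pair_swap n i \<in> {1..n}" if "i \<in> {1..n}" for i
    using that by (auto simp: pair_swap_def elim!: evenE)
  show "bij_betw (pair_swap n) {1..n} {1..n}"
    using inv range by (intro bij_betw_byWitness[where f' = "pair_swap n"]) auto
qed (auto simp: pair_swap_def)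

lemma ascent_at_pair_swap:
  assumes "i < n"
  shows "ascent_at n (pair_swap n) i \<longleftrightarrow> even i"
  using assms by (cases "i = 0"; cases "even i"; cases "Suc i = n") (auto simp: ascent_at_def pair_swap_def)

lemma peaks_pair_swap: "peaks (ascent_at n (pair_swap n)) n = n div 2"
proof -
  \<comment> \<open>Below n the descents sit exactly at the odd positions, each after an ascent.
    Position n is treated apart because it is an ascent by convention.\<close>
  have *: "peaks (ascent_at n (pair_swap n)) k = (k + 1) div 2" if "k < n" for k
    using that by (induction k) (auto simp: ascent_at_pair_swap)
  show ?thesis
  proof (cases n)
    case (Suc k)
    moreover have "ascent_at n (pair_swap n) n" by (simp add: ascent_at_def)
    ultimately show ?thesis using *[of k] by simp
  qed simp
qed

lemma shelf_dist_bounds: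
  assumes "p \<in> perms n"
  shows "peak_density m n (n div 2) \<le> fact n * shelf_dist m n p"
    and "fact n * shelf_dist m n p \<le> peak_density m n 0"
proof -
  have p: "p permutes {1..n}" using assms by (simp add: perms_def)
  note eq = shelf_dist_eq_peak_density[OF p]
  show "peak_density m n (n div 2) \<le> fact n * shelf_dist m n p"
    unfolding eq(1) using eq(2) by (intro peak_density_antimono) auto
  show "fact n * shelf_dist m n p \<le> peak_density m n 0"
    unfolding eq(1) using eq(2) by (intro peak_density_antimono) auto
qed

lemma shelf_dist_extremal:
  shows "id \<in> perms n" "fact n * shelf_dist m n id = peak_density m n 0"
    and "pair_swap n \<in> perms n" "fact n * shelf_dist m n (pair_swap n) = peak_density m n (n div 2)"
  using shelf_dist_eq_peak_density[OF permutes_id, of n] shelf_dist_eq_peak_density[OF pair_swap_permutes]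
    pair_swap_permutes permutes_id
  by (simp_all add: peaks_id peaks_pair_swap perms_def)

lemma finite_perms: "finite (perms n)"
  unfolding perms_def by (rule finite_permutations) simp

lemma sep_dist_shelf: "sep_dist n (shelf_dist m n) = 1 - peak_density m n (n div 2)"
  unfolding sep_dist_def
proof (rule Max_eqI)
  show "1 - peak_density m n (n div 2) \<in> (\<lambda>p. 1 - fact n * shelf_dist m n p) ` perms n"
    using shelf_dist_extremal(3,4) by (metis (no_types, lifting) image_eqI)
qed (use finite_perms shelf_dist_bounds in auto)

text \<open>The distance to 1 over an interval is largest at an endpoint, and both endpoints are
  densities of actual permutations.\<close>

lemma linf_dist_shelf:
  "linf_dist n (shelf_dist m n) = max (peak_density m n 0 - 1) (1 - peak_density m n (n div 2))"
  unfolding linf_dist_def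
proof (rule Max_eqI)
  let ?f = "\<lambda>p. \<bar>1 - fact n * shelf_dist m n p\<bar>"
  let ?hi = "peak_density m n 0" and ?lo = "peak_density m n (n div 2)"
  have "?lo \<le> ?hi" by (rule peak_density_antimono) auto
  then have "max (?hi - 1) (1 - ?lo) = ?f id \<or> max (?hi - 1) (1 - ?lo) = ?f (pair_swap n)"
    unfolding shelf_dist_extremal(2,4) by (auto simp: max_def)
  then show "max (?hi - 1) (1 - ?lo) \<in> ?f ` perms n"
    using shelf_dist_extremal(1,3) by blast
  show "y \<le> max (?hi - 1) (1 - ?lo)" if y: "y \<in> ?f ` perms n" for y
  proof -
    obtain p where p: "p \<in> perms n" "y = ?f p" using y by blast
    then show ?thesis using shelf_dist_bounds[OF p(1), of m] by (auto simp: max_def abs_if)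
  qed
qed (use finite_perms in auto)

section \<open>Product formula and recurrence for the extreme densities\<close>

lemma peak_density_odd: "peak_density m (2 * p + 1) p = peak_density m (2 * p) p"
proof -
  have "real (2 * m + 1) * fps_nth (peak_gf (2 * p) p) m = real (2 * p + 1) * fps_nth (peak_gf (2 * p + 1) p) m"
    unfolding odd_euler_nth[symmetric] odd_euler_even_peaks fps_mult_of_nat_nth ..
  \<comment> \<open>The new factor of the factorial is the one in the series identity, so the
    additional card contributes exactly the factor 2m+1 that the normalisation removes.\<close>
  moreover have "fact (2 * p + 1) = real (2 * p + 1) * fact (2 * p)"
    by simp
  ultimately have "fact (2 * p + 1) * fps_nth (peak_gf (2 * p + 1) p) m = real (2 * m + 1) * (fact (2 * p) * fps_nth (peak_gf (2 * p) p) m)"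
    by (simp only: mult_ac)
  then show ?thesis unfolding peak_density_def by (simp only: power_add power_one_right) (simp del: fact_Suc)
qed

text \<open>Eliminating the intermediate coefficient \<open>g1\<close> from the two series
  identities leaves a one-term recurrence with step two.\<close>

lemma peak_density_even:
  "peak_density m (2 * p + 2) (p + 1) = peak_density m (2 * p) p * (1 - ((2 * real p + 1) / real (2 * m + 1))\<^sup>2)"
proof -
  define M g0 g1 g2 where "M = real (2 * m + 1)" and "g0 = fps_nth (peak_gf (2 * p) p) m"
    and "g1 = fps_nth (peak_gf (2 * p + 1) p) m" and "g2 = fps_nth (peak_gf (2 * p + 2) (p + 1)) m"
  have M: "M > 0" by (simp add: M_def)
  have "M * g0 = (2 * real p + 1) * g1"
    using arg_cong[OF odd_euler_even_peaks[of p], of "\<lambda>f. fps_nth f m"]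
    unfolding odd_euler_nth fps_add_nth fps_sub_nth fps_mult_of_nat_nth by (simp add: M_def g0_def g1_def add_ac)
  moreover have "M * g1 = (2 * real p + 2) * g2 + (2 * real p + 1) * g0"
    using arg_cong[OF odd_euler_odd_peaks[of p], of "\<lambda>f. fps_nth f m"]
    unfolding odd_euler_nth fps_add_nth fps_sub_nth fps_mult_of_nat_nth by (simp add: M_def g0_def g1_def g2_def add_ac)
  ultimately have "(2 * real p + 1) * (2 * real p + 2) * g2 = (M\<^sup>2 - (2 * real p + 1)\<^sup>2) * g0"
    by algebra
  moreover have "fact (2 * p + 2) = (2 * real p + 1) * (2 * real p + 2) * fact (2 * p)"
    by (simp add: algebra_simps)
  ultimately have "fact (2 * p + 2) * g2 = (M\<^sup>2 - (2 * real p + 1)\<^sup>2) * g0 * fact (2 * p)"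
    by algebra
  then have "peak_density m (2 * p + 2) (p + 1) = (M\<^sup>2 - (2 * real p + 1)\<^sup>2) * g0 * fact (2 * p) / M ^ (2 * p + 2)"
    by (simp add: peak_density_def g2_def M_def)
  also have "\<dots> = fact (2 * p) * g0 / M ^ (2 * p) * (1 - ((2 * real p + 1) / M)\<^sup>2)"
    using M by (simp add: power_add field_simps power2_eq_square)
  finally show ?thesis by (simp add: peak_density_def g0_def M_def)
qed

lemma peak_density_0: "peak_density m 0 0 = 1"
  by (simp add: peak_density_def peak_gf_def geo_def)

text \<open>The factors are written as \<open>1 + - ...\<close> to match
  \<open>prod_one_plus_tendsto\<close>.\<close>

lemma peak_density_min:
  "peak_density m n (n div 2) = (\<Prod>j<n div 2. 1 + - ((2 * real j + 1) / real (2 * m + 1))\<^sup>2)"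
proof -
  have *: "peak_density m (2 * p) p = (\<Prod>j<p. 1 + - ((2 * real j + 1) / real (2 * m + 1))\<^sup>2)" for p
    using peak_density_even[of m] by (induction p) (simp_all add: peak_density_0)
  show ?thesis
  proof (cases "even n")
    case True
    then show ?thesis using *[of "n div 2"] by simp
  next
    case False
    then have "n = 2 * (n div 2) + 1" by presburger
    then show ?thesis using *[of "n div 2"] peak_density_odd[of m "n div 2"] by simp
  qed
qed

lemma peak_density_max_rec:
  "peak_density m (n + 2) 0 = peak_density m (n + 1) 0 + ((real n + 1) / real (2 * m + 1))\<^sup>2 * peak_density m n 0"
proof -
  define M g0 g1 g2 where "M = real (2 * m + 1)" and "g0 = fps_nth (peak_gf n 0) m"
    and "g1 = fps_nth (peak_gf (n + 1) 0) m" and "g2 = fps_nth (peak_gf (n + 2) 0) m"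
  have M: "M > 0" by (simp add: M_def)
  have "M * g1 = (real n + 2) * g2 - (real n + 1) * g0"
    using arg_cong[OF odd_euler_identity_gf[of n], of "\<lambda>f. fps_nth f m"]
    unfolding odd_euler_nth fps_add_nth fps_sub_nth fps_mult_of_nat_nth by (simp add: M_def g0_def g1_def g2_def add_ac)
  then have "(real n + 2) * g2 = M * g1 + (real n + 1) * g0" by simp
  moreover have "fact (n + 2) * g2 = fact (n + 1) * ((real n + 2) * g2)" by (simp add: algebra_simps)
  ultimately have "peak_density m (n + 2) 0 = fact (n + 1) * (M * g1 + (real n + 1) * g0) / M ^ (n + 2)"
    by (simp only: peak_density_def g2_def M_def)
  also have "\<dots> = fact (n + 1) * g1 / M ^ (n + 1) + ((real n + 1) / M)\<^sup>2 * (fact n * g0 / M ^ n)"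
    using M by (simp add: power_add field_simps power2_eq_square)
  finally show ?thesis by (simp add: peak_density_def g0_def g1_def M_def)
qed

section \<open>Asymptotics\<close>

text \<open>Take logarithms: ln(1+x) differs from x by at most 2x^2, so the total error is at most 2
  \<open>e n\<close> times the sum of the absolute values, which tends to 0.\<close>

lemma prod_one_plus_tendsto:
  fixes x :: "nat \<Rightarrow> nat \<Rightarrow> real"
  assumes e: "e \<longlonglongrightarrow> 0" and bound: "\<forall>\<^sub>F n in sequentially. \<forall>j<k n. \<bar>x n j\<bar> \<le> e n"
    and sum: "(\<lambda>n. \<Sum>j<k n. x n j) \<longlonglongrightarrow> L" and abs: "(\<lambda>n. \<Sum>j<k n. \<bar>x n j\<bar>) \<longlonglongrightarrow> A"
  shows "(\<lambda>n. \<Prod>j<k n. 1 + x n j) \<longlonglongrightarrow> exp L"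
proof -
  have small: "\<forall>\<^sub>F n in sequentially. e n < 1/2"
    using order_tendstoD(2)[OF e, of "1/2"] by simp
  have "(\<lambda>n. (\<Sum>j<k n. ln (1 + x n j)) - (\<Sum>j<k n. x n j)) \<longlonglongrightarrow> 0"
  proof (rule Lim_null_comparison)
    show "(\<lambda>n. 2 * e n * (\<Sum>j<k n. \<bar>x n j\<bar>)) \<longlonglongrightarrow> 0"
      using tendsto_mult[OF tendsto_mult[OF tendsto_const e] abs, of 2] by simp
    show "\<forall>\<^sub>F n in sequentially. norm ((\<Sum>j<k n. ln (1 + x n j)) - (\<Sum>j<k n. x n j)) \<le> 2 * e n * (\<Sum>j<k n. \<bar>x n j\<bar>)"
      using bound small
    proof eventually_elim
      case (elim n)
      have "\<bar>ln (1 + x n j) - x n j\<bar> \<le> 2 * e n * \<bar>x n j\<bar>" if "j < k n" for j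
      proof -
        have b: "\<bar>x n j\<bar> \<le> e n" using elim that by blast
        then have "\<bar>ln (1 + x n j) - x n j\<bar> \<le> 2 * (x n j)\<^sup>2"
          using elim by (intro abs_ln_one_plus_x_minus_x_bound) simp
        also have "(x n j)\<^sup>2 = \<bar>x n j\<bar> * \<bar>x n j\<bar>" by (simp add: power2_eq_square)
        also have "\<dots> \<le> e n * \<bar>x n j\<bar>" using b by (intro mult_right_mono) auto
        finally show ?thesis by simp
      qed
      then have "(\<Sum>j<k n. \<bar>ln (1 + x n j) - x n j\<bar>) \<le> (\<Sum>j<k n. 2 * e n * \<bar>x n j\<bar>)"
        by (intro sum_mono) auto
      then show ?case
        using sum_abs[of "\<lambda>j. ln (1 + x n j) - x n j" "{..<k n}"]
        by (simp add: sum_subtractf sum_distrib_left)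
    qed
  qed
  from tendsto_add[OF this sum] have "(\<lambda>n. exp (\<Sum>j<k n. ln (1 + x n j))) \<longlonglongrightarrow> exp L"
    by (intro tendsto_exp) simp
  moreover have "\<forall>\<^sub>F n in sequentially. exp (\<Sum>j<k n. ln (1 + x n j)) = (\<Prod>j<k n. 1 + x n j)"
    using bound small
  proof eventually_elim
    case (elim n)
    have "1 + x n j > 0" if "j < k n" for j
    proof -
      have "\<bar>x n j\<bar> \<le> e n" using elim that by blast
      then show ?thesis using elim by linarith
    qed
    then show ?case by (simp add: exp_sum)
  qed
  ultimately show ?thesis by (rule Lim_transform_eventually)
qed

lemma cube_over_square_tendsto:
  fixes m :: "nat \<Rightarrow> nat"
  assumes "0 < c" and "(\<lambda>n. real (m n) / real n powr (3/2)) \<longlonglongrightarrow> c"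
  shows "(\<lambda>n. real n ^ 3 / real (2 * m n + 1) ^ 2) \<longlonglongrightarrow> 1 / (4 * c\<^sup>2)"
proof -
  have z: "(\<lambda>n. 1 / real n powr (3/2)) \<longlonglongrightarrow> 0" by real_asymp
  have "(\<lambda>n. 2 * (real (m n) / real n powr (3/2)) + 1 / real n powr (3/2)) \<longlonglongrightarrow> 2 * c + 0"
    by (intro tendsto_intros assms z)
  then have "(\<lambda>n. 1 / (2 * (real (m n) / real n powr (3/2)) + 1 / real n powr (3/2)) ^ 2) \<longlonglongrightarrow> 1 / (2 * c) ^ 2"
    using assms by (intro tendsto_intros) auto
  moreover have "\<forall>\<^sub>F n in sequentially. 1 / (2 * (real (m n) / real n powr (3/2)) + 1 / real n powr (3/2)) ^ 2
      = real n ^ 3 / real (2 * m n + 1) ^ 2"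
    using eventually_gt_at_top[of 0]
  proof eventually_elim
    case (elim n)
    have "(real n powr (3/2)) ^ 2 = real n powr (3/2 + 3/2)" by (simp only: power2_eq_square powr_add)
    also have "\<dots> = real n ^ 3" using elim by (simp add: powr_numeral)
    finally have "(real n powr (3/2)) ^ 2 = real n ^ 3" .
    moreover have "2 * (real (m n) / real n powr (3/2)) + 1 / real n powr (3/2) = real (2 * m n + 1) / real n powr (3/2)"
      by (simp add: add_divide_distrib)
    ultimately show ?case by (simp only: power_divide) simp
  qed
  ultimately have "(\<lambda>n. real n ^ 3 / real (2 * m n + 1) ^ 2) \<longlonglongrightarrow> 1 / (2 * c) ^ 2"
    by (rule Lim_transform_eventually)
  then show ?thesis by (simp add: power_mult_distrib)
qed

text \<open>The quotient is the convergent one divided by n. It serves as the uniform bound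
  \<open>e\<close> on the deviations of the factors from 1.\<close>

lemma square_over_square_tendsto:
  fixes M :: "nat \<Rightarrow> real"
  assumes "(\<lambda>n. real n ^ 3 / M n ^ 2) \<longlonglongrightarrow> L"
  shows "(\<lambda>n. (real n / M n) ^ 2) \<longlonglongrightarrow> 0"
proof -
  have "(\<lambda>n. real n ^ 3 / M n ^ 2 * (1 / real n)) \<longlonglongrightarrow> L * 0"
    by (intro tendsto_mult assms lim_1_over_n)
  moreover have "\<forall>\<^sub>F n in sequentially. real n ^ 3 / M n ^ 2 * (1 / real n) = (real n / M n) ^ 2"
    using eventually_gt_at_top[of 0]
    by eventually_elim (simp add: power_divide power2_eq_square power3_eq_cube)
  ultimately show ?thesis using Lim_transform_eventually by fastforce
qed

section \<open>Limit of the minimal density\<close>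

lemma sum_odd_squares: "(\<Sum>j<p. (2 * real j + 1)\<^sup>2) = real p * (4 * (real p)\<^sup>2 - 1) / 3"
  by (induction p) (simp_all add: power2_eq_square field_simps)

lemma sum_squares: "(\<Sum>j<p. (real j + 1)\<^sup>2) = real p * (real p + 1) * (2 * real p + 1) / 6"
  by (induction p) (simp_all add: power2_eq_square field_simps)

lemma half_tendsto: "(\<lambda>n. real (n div 2) / real n) \<longlonglongrightarrow> 1/2"
proof (rule tendsto_sandwich)
  have half: "(real n - 1) / 2 \<le> real (n div 2)" "real (n div 2) \<le> real n / 2" for n :: nat
    by (cases "even n"; auto elim!: evenE oddE)+
  show "\<forall>\<^sub>F n in sequentially. (real n - 1) / 2 / real n \<le> real (n div 2) / real n"
    by (intro always_eventually allI divide_right_mono half of_nat_0_le_iff)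
  show "\<forall>\<^sub>F n in sequentially. real (n div 2) / real n \<le> real n / 2 / real n"
    by (intro always_eventually allI divide_right_mono half of_nat_0_le_iff)
qed real_asymp+

lemma peak_density_min_tendsto:
  assumes lim: "(\<lambda>n. real n ^ 3 / real (2 * m n + 1) ^ 2) \<longlonglongrightarrow> L"
  shows "(\<lambda>n. peak_density (m n) n (n div 2)) \<longlonglongrightarrow> exp (- (L / 6))"
proof -
  let ?M = "\<lambda>n. real (2 * m n + 1)"
  have S: "(\<lambda>n. \<Sum>j<n div 2. ((2 * real j + 1) / ?M n)\<^sup>2) \<longlonglongrightarrow> L / 6"
  proof -
    \<comment> \<open>The closed form of the sum, divided by n^3 and expressed through ratios
      tending to 1/2 and 0; the squares of the odd numbers below n add up to about n^3/6.\<close>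
    have "(\<lambda>n. real n ^ 3 / ?M n ^ 2 * ((real (n div 2) / real n) * (4 * (real (n div 2) / real n)\<^sup>2 - (1 / real n)\<^sup>2) / 3))
        \<longlonglongrightarrow> L * ((1/2) * (4 * (1/2)\<^sup>2 - 0\<^sup>2) / 3)"
      by (intro tendsto_intros lim half_tendsto lim_1_over_n) simp
    moreover have "\<forall>\<^sub>F n in sequentially. real n ^ 3 / ?M n ^ 2 * ((real (n div 2) / real n) * (4 * (real (n div 2) / real n)\<^sup>2 - (1 / real n)\<^sup>2) / 3)
       = (\<Sum>j<n div 2. ((2 * real j + 1) / ?M n)\<^sup>2)"
      using eventually_gt_at_top[of 0]
    proof eventually_elim
      case (elim n)
      define P M where "P = real (n div 2)" and "M = ?M n"
      have "M > 0" by (simp add: M_def)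
      have "(\<Sum>j<n div 2. ((2 * real j + 1) / M)\<^sup>2) = P * (4 * P\<^sup>2 - 1) / 3 / M\<^sup>2"
        unfolding power_divide sum_divide_distrib[symmetric] sum_odd_squares P_def ..
      also have "\<dots> = real n ^ 3 / M\<^sup>2 * ((P / real n) * (4 * (P / real n)\<^sup>2 - (1 / real n)\<^sup>2) / 3)"
        using elim \<open>M > 0\<close> by (simp add: field_simps power2_eq_square power3_eq_cube)
      finally show ?case by (simp only: P_def M_def)
    qed
    ultimately show ?thesis using Lim_transform_eventually by (fastforce simp: power2_eq_square)
  qed
  show ?thesis
    unfolding peak_density_min
  proof (rule prod_one_plus_tendsto)
    show "(\<lambda>n. (real n / ?M n)\<^sup>2) \<longlonglongrightarrow> 0" by (rule square_over_square_tendsto[OF lim])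
    show "\<forall>\<^sub>F n in sequentially. \<forall>j<n div 2. \<bar>- ((2 * real j + 1) / ?M n)\<^sup>2\<bar> \<le> (real n / ?M n)\<^sup>2"
    proof (intro always_eventually allI impI)
      fix n j :: nat assume "j < n div 2"
      then have "2 * real j + 1 \<le> real n" by linarith
      then have "(2 * real j + 1) / ?M n \<le> real n / ?M n" by (intro divide_right_mono) auto
      then show "\<bar>- ((2 * real j + 1) / ?M n)\<^sup>2\<bar> \<le> (real n / ?M n)\<^sup>2"
        by (simp only: abs_minus abs_power2) (intro power_mono; simp)
    qed
    show "(\<lambda>n. \<Sum>j<n div 2. - ((2 * real j + 1) / ?M n)\<^sup>2) \<longlonglongrightarrow> - (L / 6)"
      unfolding sum_negf by (intro tendsto_minus S)
    show "(\<lambda>n. \<Sum>j<n div 2. \<bar>- ((2 * real j + 1) / ?M n)\<^sup>2\<bar>) \<longlonglongrightarrow> L / 6"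
      unfolding abs_minus abs_power2 by (rule S)
  qed
qed

section \<open>The density of the identity as a product, and its limit\<close>

definition id_ratio :: "nat \<Rightarrow> nat \<Rightarrow> real" where
  "id_ratio m j = ((real j + 1) / real (2 * m + 1))\<^sup>2 * (peak_density m j 0 / peak_density m (j + 1) 0)"

lemma peak_density_1: "peak_density m 1 0 = 1"
  using peak_density_odd[of m 0] by (simp add: peak_density_0)

lemma peak_density_max_pos: "peak_density m n 0 > 0"
proof -
  have "peak_density m n 0 > 0 \<and> peak_density m (n + 1) 0 > 0"
  proof (induction n)
    case 0
    then show ?case using peak_density_1[of m] by (simp add: peak_density_0)
  next
    case (Suc n)
    then show ?case using peak_density_max_rec[of m n] by (auto intro!: add_pos_nonneg)
  qed
  then show ?thesis ..
qed

text \<open>Dividing the second-order recurrence by the middle term makes it multiplicative, with a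
  ratio of two earlier densities hidden in \<open>id_ratio\<close>.\<close>

lemma peak_density_max_Suc: "peak_density m (j + 2) 0 = peak_density m (j + 1) 0 * (1 + id_ratio m j)"
  using peak_density_max_rec[of m j] peak_density_max_pos[of m "j + 1"]
  by (simp add: id_ratio_def field_simps)

text \<open>There are n-1 factors because the densities for 0 and 1 cards both equal 1.\<close>

lemma peak_density_max: "peak_density m n 0 = (\<Prod>j<n - 1. 1 + id_ratio m j)"
proof (cases n)
  case (Suc k)
  have "peak_density m (k + 1) 0 = (\<Prod>j<k. 1 + id_ratio m j)"
  proof (induction k)
    case 0
    then show ?case using peak_density_1[of m] by simp
  next
    case (Suc k)
    then show ?case using peak_density_max_Suc[of m k] by simp
  qed
  then show ?thesis using Suc by simp
qed (simp add: peak_density_0)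

lemma id_ratio_nonneg: "0 \<le> id_ratio m j"
  unfolding id_ratio_def using peak_density_max_pos[of m]
  by (intro mult_nonneg_nonneg divide_nonneg_nonneg) (simp_all add: less_imp_le)

text \<open>The density of the identity grows weakly with the deck, so the quotient inside
  \<open>id_ratio\<close> is at most 1.\<close>

lemma id_ratio_le: "id_ratio m j \<le> ((real j + 1) / real (2 * m + 1))\<^sup>2"
proof -
  have "peak_density m j 0 \<le> peak_density m (j + 1) 0"
  proof (cases j)
    case 0
    then show ?thesis using peak_density_1[of m] by (simp add: peak_density_0)
  next
    case (Suc k)
    then show ?thesis
      using peak_density_max_Suc[of m k] id_ratio_nonneg[of m k] peak_density_max_pos[of m j]
      by simp
  qed
  then have "peak_density m j 0 / peak_density m (j + 1) 0 \<le> 1"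
    using peak_density_max_pos[of m "j + 1"] by simp
  then show ?thesis unfolding id_ratio_def by (intro mult_left_le) auto
qed

text \<open>The upper bound on the preceding ratio limits the growth from j to j+1 cards to a factor
  1 + (n/M)^2, where M = 2m+1; this bounds the quotient inside \<open>id_ratio\<close> from
  below.\<close>

lemma id_ratio_ge:
  assumes "j < n"
  shows "((real j + 1) / real (2 * m + 1))\<^sup>2 / (1 + (real n / real (2 * m + 1))\<^sup>2) \<le> id_ratio m j"
proof -
  let ?e = "(real n / real (2 * m + 1))\<^sup>2"
  have "peak_density m (j + 1) 0 \<le> peak_density m j 0 * (1 + ?e)"
  proof (cases j)
    case 0
    then show ?thesis using peak_density_1[of m] by (simp add: peak_density_0)
  next
    case (Suc k)
    have "id_ratio m k \<le> ((real k + 1) / real (2 * m + 1))\<^sup>2" by (rule id_ratio_le)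
    also have "\<dots> \<le> ?e" using assms Suc by (intro power_mono divide_right_mono) auto
    finally have "peak_density m j 0 * (1 + id_ratio m k) \<le> peak_density m j 0 * (1 + ?e)"
      using peak_density_max_pos[of m j] by (intro mult_left_mono) auto
    then show ?thesis using peak_density_max_Suc[of m k] Suc by simp
  qed
  moreover have "1 + ?e > 0" by (simp add: add_pos_nonneg)
  ultimately have "1 / (1 + ?e) \<le> peak_density m j 0 / peak_density m (j + 1) 0"
    using peak_density_max_pos[of m "j + 1"] by (simp add: field_simps)
  from mult_left_mono[OF this, of "((real j + 1) / real (2 * m + 1))\<^sup>2"] show ?thesis
    by (simp add: id_ratio_def)
qed

text \<open>The bounds on \<open>id_ratio\<close> differ by the factor 1 + (n/M)^2, which tends to
  1, so its sum behaves like that of ((j+1)/M)^2, about n^3/(3 M^2).\<close>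

lemma peak_density_max_tendsto:
  assumes lim: "(\<lambda>n. real n ^ 3 / real (2 * m n + 1) ^ 2) \<longlonglongrightarrow> L"
  shows "(\<lambda>n. peak_density (m n) n 0) \<longlonglongrightarrow> exp (L / 3)"
proof -
  let ?M = "\<lambda>n. real (2 * m n + 1)"
  let ?e = "\<lambda>n. (real n / ?M n)\<^sup>2"
  have e: "?e \<longlonglongrightarrow> 0" by (rule square_over_square_tendsto[OF lim])
  have S: "(\<lambda>n. \<Sum>j<n - 1. ((real j + 1) / ?M n)\<^sup>2) \<longlonglongrightarrow> L / 3"
  proof -
    have "(\<lambda>n. real n ^ 3 / ?M n ^ 2 * ((1 - 1 / real n) * (2 - 1 / real n) / 6))
        \<longlonglongrightarrow> L * ((1 - 0) * (2 - 0) / 6)"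
      by (intro tendsto_intros lim lim_1_over_n) simp
    moreover have "\<forall>\<^sub>F n in sequentially. real n ^ 3 / ?M n ^ 2 * ((1 - 1 / real n) * (2 - 1 / real n) / 6)
       = (\<Sum>j<n - 1. ((real j + 1) / ?M n)\<^sup>2)"
      using eventually_gt_at_top[of 0]
    proof eventually_elim
      case (elim n)
      define M where "M = ?M n"
      have "M > 0" by (simp add: M_def)
      have "(\<Sum>j<n - 1. ((real j + 1) / M)\<^sup>2) = (real n - 1) * real n * (2 * real n - 1) / 6 / M\<^sup>2"
        unfolding power_divide sum_divide_distrib[symmetric] sum_squares using elim by (simp add: of_nat_diff algebra_simps)
      also have "\<dots> = real n ^ 3 / M\<^sup>2 * ((1 - 1 / real n) * (2 - 1 / real n) / 6)"
        using elim \<open>M > 0\<close> by (simp add: field_simps power2_eq_square power3_eq_cube)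
      finally show ?case by (simp only: M_def)
    qed
    ultimately show ?thesis using Lim_transform_eventually by fastforce
  qed
  have sum: "(\<lambda>n. \<Sum>j<n - 1. id_ratio (m n) j) \<longlonglongrightarrow> L / 3"
  proof (rule tendsto_sandwich)
    show "(\<lambda>n. (\<Sum>j<n - 1. ((real j + 1) / ?M n)\<^sup>2) / (1 + ?e n)) \<longlonglongrightarrow> L / 3"
      using tendsto_divide[OF S tendsto_add[OF tendsto_const e], of 1] by simp
    show "\<forall>\<^sub>F n in sequentially. (\<Sum>j<n - 1. ((real j + 1) / ?M n)\<^sup>2) / (1 + ?e n) \<le> (\<Sum>j<n - 1. id_ratio (m n) j)"
      unfolding sum_divide_distrib by (intro always_eventually allI sum_mono id_ratio_ge) auto
    show "\<forall>\<^sub>F n in sequentially. (\<Sum>j<n - 1. id_ratio (m n) j) \<le> (\<Sum>j<n - 1. ((real j + 1) / ?M n)\<^sup>2)"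
      by (intro always_eventually allI sum_mono id_ratio_le)
  qed (rule S)
  have abs: "\<bar>id_ratio a j\<bar> = id_ratio a j" for a j using id_ratio_nonneg by simp
  show ?thesis
    unfolding peak_density_max
  proof (rule prod_one_plus_tendsto[OF e _ sum])
    show "\<forall>\<^sub>F n in sequentially. \<forall>j<n - 1. \<bar>id_ratio (m n) j\<bar> \<le> ?e n"
      unfolding abs
    proof (intro always_eventually allI impI)
      fix n j :: nat assume "j < n - 1"
      then have "((real j + 1) / ?M n)\<^sup>2 \<le> ?e n" by (intro power_mono divide_right_mono) auto
      then show "id_ratio (m n) j \<le> ?e n" using id_ratio_le order_trans by blast
    qed
    show "(\<lambda>n. \<Sum>j<n - 1. \<bar>id_ratio (m n) j\<bar>) \<longlonglongrightarrow> L / 3" unfolding abs by (rule sum)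
  qed
qed

theorem theorem4p2:
  fixes c :: real and m :: "nat \<Rightarrow> nat"
  assumes "0 < c"
    and "(\<lambda>n. real (m n) / real n powr (3/2)) \<longlonglongrightarrow> c"
  shows "(\<lambda>n. linf_dist n (shelf_dist (m n) n)) \<sim>[sequentially] (\<lambda>n. exp (1 / (12 * c^2)) - 1)
     \<and> (\<lambda>n. sep_dist n (shelf_dist (m n) n)) \<sim>[sequentially] (\<lambda>n. 1 - exp (- 1 / (24 * c^2)))"
proof -
  note lim = cube_over_square_tendsto[OF assms]
  \<comment> \<open>With L = 1/(4c^2), the exponents L/6 and L/3 of the two limits are y and
    2y.\<close>
  define y where "y = 1 / (24 * c\<^sup>2)"
  have y: "y > 0" using assms(1) by (simp add: y_def)
  have lo: "(\<lambda>n. peak_density (m n) n (n div 2)) \<longlonglongrightarrow> exp (- y)"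
    using peak_density_min_tendsto[OF lim] by (simp add: y_def)
  have hi: "(\<lambda>n. peak_density (m n) n 0) \<longlonglongrightarrow> exp (2 * y)"
    using peak_density_max_tendsto[OF lim] by (simp add: y_def)
  \<comment> \<open>Both sides are separated by y and 2y, so in the limit the identity, not the
    paired swaps, determines the maximum.\<close>
  have "1 - exp (- y) \<le> exp (2 * y) - 1"
    using exp_ge_add_one_self[of "2 * y"] exp_ge_add_one_self[of "- y"] y by linarith
  then have max: "max (exp (2 * y) - 1) (1 - exp (- y)) = exp (2 * y) - 1" by simp
  have "(\<lambda>n. linf_dist n (shelf_dist (m n) n)) \<longlonglongrightarrow> max (exp (2 * y) - 1) (1 - exp (- y))"
    unfolding linf_dist_shelf by (intro tendsto_intros lo hi)
  then have "(\<lambda>n. linf_dist n (shelf_dist (m n) n)) \<longlonglongrightarrow> exp (2 * y) - 1" unfolding max .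
  \<comment> \<open>Positivity of \<open>y\<close> makes the limit nonzero, so convergence yields
    asymptotic equivalence to the constant.\<close>
  then have "(\<lambda>n. linf_dist n (shelf_dist (m n) n)) \<sim>[sequentially] (\<lambda>n. exp (2 * y) - 1)"
    by (rule tendsto_imp_asymp_equiv_const) (use y in simp)
  moreover have "(\<lambda>n. sep_dist n (shelf_dist (m n) n)) \<longlonglongrightarrow> 1 - exp (- y)"
    unfolding sep_dist_shelf by (intro tendsto_intros lo)
  then have "(\<lambda>n. sep_dist n (shelf_dist (m n) n)) \<sim>[sequentially] (\<lambda>n. 1 - exp (- y))"
    by (rule tendsto_imp_asymp_equiv_const) (use y in simp)
  moreover have "2 * y = 1 / (12 * c^2)" "- y = - 1 / (24 * c^2)" by (simp_all add: y_def)
  ultimately show ?thesis by simp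
qed

end
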